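(* Let $k \geq 1$ be an integer, let $(T_i)_{i\ge 0}$ be the Tribonacci sequence, and let $S = \{T_3, T_4, \ldots, T_{k+2}\}$, a set of $k$ jars. Then $$\mathrm{CM}(S) = \left\lfloor \frac{2k}{3} \right\rfloor + 1.$$
   Context: A finite set $S$ of distinct positive integers is regarded as a set of jars, the jar corresponding to $s \in S$ initially containing $s$ cookies. On a move, the Cookie Monster chooses a subset of the jars and a positive integer $a$ and removes exactly $a$ cookies from each jar of the chosen subset (each chosen jar must contain at least $a$ cookies at that time). The Cookie Monster number $\mathrm{CM}(S)$ is the minimum number of moves needed to empty all of the jars. The Tribonacci sequence is defined by $T_0 = T_1 = 0$, $T_2 = 1$, and $T_i = T_{i-3} + T_{i-2} + T_{i-1}$ for $i \geq 3$; it begins $0, 0, 1, 1, 2, 4, 7, 13, 24, 44, 81, \ldots$. *)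

theory Defs imports Main begin

fun trib :: "nat \<Rightarrow> nat" where
  "trib 0 = 0"
| "trib (Suc 0) = 0"
| "trib (Suc (Suc 0)) = 1"
| "trib (Suc (Suc (Suc n))) = trib n + trib (Suc n) + trib (Suc (Suc n))"

text \<open>Jars are named by their initial contents, so a state assigns to each name \<open>s \<in> S\<close> the
  current number of cookies in the jar that started with \<open>s\<close> cookies. Two jars may hold equal
  numbers of cookies later on and remain distinct jars. Values outside \<open>S\<close> play no role.\<close>

definition cm_move :: "nat set \<Rightarrow> (nat \<Rightarrow> nat) \<Rightarrow> (nat \<Rightarrow> nat) \<Rightarrow> bool" where
  "cm_move S c c' \<longleftrightarrow> (\<exists>J a. J \<subseteq> S \<and> a > 0 \<and> (\<forall>s\<in>J. a \<le> c s) \<and>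
     c' = (\<lambda>s. if s \<in> J then c s - a else c s))"

definition can_empty_in :: "nat set \<Rightarrow> nat \<Rightarrow> bool" where
  "can_empty_in S n \<longleftrightarrow> (\<exists>c. (cm_move S ^^ n) (\<lambda>s. s) c \<and> (\<forall>s\<in>S. c s = 0))"

definition CM :: "nat set \<Rightarrow> nat" where
  "CM S = (LEAST n. can_empty_in S n)"

text \<open>The minimum defining \<open>CM\<close> is attained for finite \<open>S\<close>: the jars can be emptied one at a time.\<close>

lemma can_empty_in_card:
  assumes "finite S" "0 \<notin> S"
  shows "can_empty_in S (card S)"
proof -
  have "(cm_move S ^^ card A) (\<lambda>s. s) (\<lambda>s. if s \<in> A then 0 else s)"
    if "finite A" "A \<subseteq> S" for A
    using that
  proof (induction A rule: finite_induct)
    case empty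
    then show ?case by simp
  next
    case (insert x A)
    have "x > 0" using insert.prems assms(2) by (metis gr0I insert_subset)
    then have "cm_move S (\<lambda>s. if s \<in> A then 0 else s) (\<lambda>s. if s \<in> insert x A then 0 else s)"
      unfolding cm_move_def
      using insert by (intro exI[of _ "{x}"] exI[of _ x]) auto
    moreover have "(cm_move S ^^ card A) (\<lambda>s. s) (\<lambda>s. if s \<in> A then 0 else s)"
      using insert by blast
    ultimately show ?case
      using insert.hyps by auto
  qed
  from this[of S] assms(1) show ?thesis
    unfolding can_empty_in_def by (intro exI[of _ "\<lambda>s. if s \<in> S then 0 else s"]) auto
qed

end

theory Submission imports Defs begin

text \<open>The jars can be emptied in \<open>n\<close> moves iff there are \<open>n\<close> positive amounts such that every
  \<open>s \<in> S\<close> is a sum of some of them. From \<open>T\<^sub>n = T\<^sub>n\<^sub>-\<^sub>1 + T\<^sub>n\<^sub>-\<^sub>2 + T\<^sub>n\<^sub>-\<^sub>3\<close>, three more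
  jars cost at most two more amounts, namely the contents of the first two of them. Conversely, the
  amounts used by the jars up to \<open>T\<^sub>n\<close> sum to at most \<open>T\<^sub>3 + \<dots> + T\<^sub>n < T\<^sub>n\<^sub>+\<^sub>2\<close>, which
  implies that among three consecutive jars at most one needs no new amount.\<close>

section \<open>Moves as subset sums\<close>

lemma relpowp_cm_move_imp_sum:
  assumes "(cm_move S ^^ n) c c'"
  shows "\<exists>a A. \<forall>s. A s \<subseteq> {..<n} \<and> c s = c' s + sum a (A s)"
  using assms
proof (induction n arbitrary: c')
  case 0
  then show ?case by (auto intro!: exI[of _ "\<lambda>_. {}"])
next
  case (Suc n)
  then obtain d where d: "(cm_move S ^^ n) c d" "cm_move S d c'"
    by auto
  from Suc.IH[OF d(1)] obtain a A
    where A: "\<And>s. A s \<subseteq> {..<n}" "\<And>s. c s = d s + sum a (A s)"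
    by blast
  from d(2) obtain J b where J: "\<forall>s\<in>J. b \<le> d s" "c' = (\<lambda>s. if s \<in> J then d s - b else d s)"
    unfolding cm_move_def by blast
  \<comment> \<open>\<open>a i\<close> is the amount removed by move \<open>i\<close>, and
    \<open>A s\<close> is the set of moves that use jar \<open>s\<close>. The new move gets the
    fresh index \<open>n\<close>, so earlier sums do not change.\<close>
  define A' where "A' = (\<lambda>s. if s \<in> J then insert n (A s) else A s)"
  have "A' s \<subseteq> {..<Suc n} \<and> c s = c' s + sum (a(n := b)) (A' s)" for s
  proof -
    have "n \<notin> A s" "finite (A s)"
      using A(1)[of s] by (auto intro: finite_subset)
    moreover have "sum (a(n := b)) (A s) = sum a (A s)"
      using \<open>n \<notin> A s\<close> by (intro sum.cong) auto
    ultimately show ?thesis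
      using A(1)[of s] A(2)[of s] J by (auto simp: A'_def)
  qed
  then show ?case by blast
qed

lemma can_empty_in_iff:
  "can_empty_in S n \<longleftrightarrow> (\<exists>a. (\<forall>i<n. 0 < a i) \<and> S \<subseteq> sum a ` Pow {..<n})"
proof
  assume "can_empty_in S n"
  then obtain c where c: "(cm_move S ^^ n) (\<lambda>s. s) c" "\<forall>s\<in>S. c s = 0"
    unfolding can_empty_in_def by blast
  from relpowp_cm_move_imp_sum[OF c(1)] obtain a A
    where A: "\<And>s. A s \<subseteq> {..<n}" "\<And>s. s = c s + sum a (A s)"
    by blast
  \<comment> \<open>The amounts from the previous lemma may be zero. Such an amount is replaced by 1
    and its index is dropped from every \<open>A s\<close>, which preserves the sums.\<close>
  define a' where "a' = (\<lambda>i. if a i = 0 then 1 else a i)"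
  define A' where "A' = (\<lambda>s. {i \<in> A s. a i \<noteq> 0})"
  have "s \<in> sum a' ` Pow {..<n}" if "s \<in> S" for s
  proof (rule image_eqI)
    have "finite (A s)" using A(1)[of s] finite_subset by blast
    then have "sum a (A s) = sum a' (A' s)"
      by (intro sum.mono_neutral_cong_right) (auto simp: a'_def A'_def)
    then show "s = sum a' (A' s)" using A(2)[of s] c(2) that by simp
    show "A' s \<in> Pow {..<n}" using A(1)[of s] by (auto simp: A'_def)
  qed
  moreover have "\<forall>i<n. 0 < a' i" by (simp add: a'_def)
  ultimately show "\<exists>a. (\<forall>i<n. 0 < a i) \<and> S \<subseteq> sum a ` Pow {..<n}" by blast
next
  assume "\<exists>a. (\<forall>i<n. 0 < a i) \<and> S \<subseteq> sum a ` Pow {..<n}"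
  then obtain a where a: "\<And>i. i < n \<Longrightarrow> 0 < a i" "S \<subseteq> sum a ` Pow {..<n}"
    by blast
  then have "\<forall>s\<in>S. \<exists>B. B \<subseteq> {..<n} \<and> s = sum a B" by blast
  then obtain A where A: "\<And>s. s \<in> S \<Longrightarrow> A s \<subseteq> {..<n}" "\<And>s. s \<in> S \<Longrightarrow> s = sum a (A s)"
    by metis
  \<comment> \<open>The state after moves 0 to \<open>m - 1\<close>: jar \<open>s\<close> still
    holds the amounts of its later moves. Names outside \<open>S\<close> keep their initial value,
    since no move touches them.\<close>
  define c where "c = (\<lambda>m s. if s \<in> S then sum a (A s - {..<m}) else s)"
  have fin: "finite (A s)" if "s \<in> S" for s
    using A(1)[OF that] finite_subset by blast
  have "(cm_move S ^^ m) (\<lambda>s. s) (c m)" if "m \<le> n" for m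
    using that
  proof (induction m)
    case 0
    have "c 0 = (\<lambda>s. s)" using A(2) by (auto simp: c_def)
    then show ?case by simp
  next
    case (Suc m)
    define J where "J = {s \<in> S. m \<in> A s}"
    \<comment> \<open>Stated with addition, this gives both \<open>a m \<le> c m s\<close> and the
      value after the move.\<close>
    have c_J: "c m s = a m + c (Suc m) s" if "s \<in> J" for s
    proof -
      have "A s - {..<m} = insert m (A s - {..<Suc m})" "finite (A s)"
        using that fin by (auto simp: J_def)
      then show ?thesis using that by (simp add: c_def J_def)
    qed
    have c_notJ: "c m s = c (Suc m) s" if "s \<notin> J" for s
    proof -
      have "A s - {..<m} = A s - {..<Suc m}" if "s \<in> S"
        using \<open>s \<notin> J\<close> that by (auto simp: J_def less_Suc_eq)
      then show ?thesis by (simp add: c_def)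
    qed
    have "cm_move S (c m) (c (Suc m))"
      unfolding cm_move_def using c_J c_notJ a(1)[of m] Suc.prems
      by (intro exI[of _ J] exI[of _ "a m"]) (auto simp: J_def)
    moreover have "(cm_move S ^^ m) (\<lambda>s. s) (c m)"
      using Suc by simp
    ultimately show ?case by auto
  qed
  moreover have "c n s = 0" if "s \<in> S" for s
  proof -
    have "A s - {..<n} = {}" using A(1)[OF that] by blast
    then show ?thesis using that unfolding c_def by (simp only: sum.empty if_True)
  qed
  ultimately show "can_empty_in S n"
    unfolding can_empty_in_def by blast
qed

section \<open>Tribonacci numbers\<close>

lemma trib_step: "trib (n + 3) = trib n + trib (n + 1) + trib (n + 2)"
  by (simp add: numeral_eq_Suc)

lemma trib_3_4_5: "trib 3 = 1" "trib 4 = 2" "trib 5 = 4"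
  by (simp_all add: numeral_eq_Suc)

lemma trib_pos: "2 \<le> n \<Longrightarrow> 0 < trib n"
  by (induction n rule: trib.induct) auto

text \<open>By induction the sum up to \<open>n + 1\<close> is below
  \<open>trib (n + 2) + trib (n + 1)\<close>, and the recurrence bounds this by
  \<open>trib (n + 3)\<close>. Empty sums need only positivity.\<close>

lemma sum_trib_less: "(\<Sum>i=3..n. trib i) < trib (n + 2)"
proof (induction n)
  case 0
  then show ?case by (simp add: numeral_eq_Suc)
next
  case (Suc n)
  then show ?case
    using trib_step[of n] trib_pos[of "Suc n + 2"] by (cases "3 \<le> Suc n") (auto simp: numeral_eq_Suc)
qed

section \<open>Upper bound\<close>

lemma subset_sums_extend:
  fixes a :: "nat \<Rightarrow> 'a::comm_monoid_add"
  assumes "t \<in> sum a ` Pow {..<n}"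
  shows "t \<in> sum (a(n := x)) ` Pow {..<Suc n}" "x + t \<in> sum (a(n := x)) ` Pow {..<Suc n}"
proof -
  obtain B where B: "B \<subseteq> {..<n}" "t = sum a B" using assms by blast
  have "n \<notin> B" "finite B" using B(1) by (auto intro: finite_subset)
  moreover have "sum (a(n := x)) B = t"
    unfolding B(2) using \<open>n \<notin> B\<close> by (intro sum.cong) auto
  ultimately have "t = sum (a(n := x)) B" "x + t = sum (a(n := x)) (insert n B)"
    by simp_all
  moreover have "B \<in> Pow {..<Suc n}" "insert n B \<in> Pow {..<Suc n}"
    using B(1) by auto
  ultimately show "t \<in> sum (a(n := x)) ` Pow {..<Suc n}" "x + t \<in> sum (a(n := x)) ` Pow {..<Suc n}"
    by blast+
qed

text \<open>One more amount \<open>x\<close> can be added to any old subset sum: to the empty one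
  for the jar \<open>x\<close>, to the one for \<open>s\<close> for the jar
  \<open>x + s\<close>.\<close>

lemma can_empty_in_insert:
  assumes "can_empty_in S n" "x > 0"
  shows "can_empty_in (insert x S \<union> (+) x ` S) (Suc n)"
proof -
  obtain a where a: "\<And>i. i < n \<Longrightarrow> 0 < a i" "S \<subseteq> sum a ` Pow {..<n}"
    using assms(1) unfolding can_empty_in_iff by blast
  have "0 \<in> sum a ` Pow {..<n}" by (auto intro!: image_eqI[of _ _ "{}"])
  then have "x \<in> sum (a(n := x)) ` Pow {..<Suc n}"
    using subset_sums_extend(2)[of 0 a n x] by (simp only: add_0_right)
  moreover have "S \<union> (+) x ` S \<subseteq> sum (a(n := x)) ` Pow {..<Suc n}"
    using subsetD[OF a(2), THEN subset_sums_extend(1)] subsetD[OF a(2), THEN subset_sums_extend(2)]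
    by blast
  ultimately have "insert x S \<union> (+) x ` S \<subseteq> sum (a(n := x)) ` Pow {..<Suc n}"
    by blast
  then show ?thesis
    unfolding can_empty_in_iff using a(1) assms(2)
    by (intro exI[of _ "a(n := x)"]) (auto simp: less_Suc_eq)
qed

lemma can_empty_in_subset: "can_empty_in S n \<Longrightarrow> R \<subseteq> S \<Longrightarrow> can_empty_in R n"
  unfolding can_empty_in_iff by blast

lemma can_empty_in_trib: "k \<ge> 1 \<Longrightarrow> can_empty_in (trib ` {3..k + 2}) (2 * k div 3 + 1)"
proof (induction k rule: less_induct)
  case (less k)
  have one: "can_empty_in {1} 1"
    using can_empty_in_card[of "{1}"] by simp
  have two: "can_empty_in {1, 2} 2"
    using can_empty_in_card[of "{1, 2}"] by (simp add: eval_nat_numeral)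
  have three: "can_empty_in {1, 2, 4} 3"
    using can_empty_in_card[of "{1, 2, 4}"] by (simp add: eval_nat_numeral)
  \<comment> \<open>The step from \<open>j\<close> to \<open>j + 3\<close> jars uses
    \<open>trib (j + 2)\<close> as an old jar, which requires \<open>j \<ge> 1\<close>; hence three
    base cases.\<close>
  consider "k = 1" | "k = 2" | "k = 3" | j where "k = j + 3" "j \<ge> 1"
  proof -
    have "k = 1 \<or> k = 2 \<or> k = 3 \<or> (k = (k - 3) + 3 \<and> k - 3 \<ge> 1)"
      using less.prems by linarith
    then show ?thesis using that by blast
  qed
  then show ?case
  proof cases
    case 1
    have "{3..k + 2} = {3}" using 1 by auto
    then have "trib ` {3..k + 2} = {1}" by (simp only: image_insert image_empty trib_3_4_5)
    moreover have "2 * k div 3 + 1 = 1" using 1 by simp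
    ultimately show ?thesis using one by (simp only:)
  next
    case 2
    have "{3..k + 2} = {3, 4}" using 2 by auto
    then have "trib ` {3..k + 2} = {1, 2}" by (simp only: image_insert image_empty trib_3_4_5)
    moreover have "2 * k div 3 + 1 = 2" using 2 by simp
    ultimately show ?thesis using two by (simp only:)
  next
    case 3
    have "{3..k + 2} = {3, 4, 5}" using 3 by auto
    then have "trib ` {3..k + 2} = {1, 2, 4}" by (simp only: image_insert image_empty trib_3_4_5)
    moreover have "2 * k div 3 + 1 = 3" using 3 by simp
    ultimately show ?thesis using three by (simp only:)
  next
    case 4
    define S where "S = trib ` {3..j + 2}"
    define x where "x = trib (j + 3)"
    define y where "y = trib (j + 4)"
    have "can_empty_in S (2 * j div 3 + 1)"
      using less.IH[of j] 4 by (simp add: S_def)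
    moreover have "x > 0" "y > 0"
      by (simp_all add: x_def y_def trib_pos)
    \<comment> \<open>The second extension also shifts the sums made with \<open>x\<close>, so it
      reaches \<open>y + (x + trib (j + 2))\<close>, the third new jar.\<close>
    ultimately have "can_empty_in (insert y (insert x S \<union> (+) x ` S) \<union> (+) y ` (insert x S \<union> (+) x ` S))
        (Suc (Suc (2 * j div 3 + 1)))"
      by (intro can_empty_in_insert)
    moreover have "trib ` {3..k + 2} \<subseteq> insert y (insert x S \<union> (+) x ` S) \<union> (+) y ` (insert x S \<union> (+) x ` S)"
    proof -
      have "{3..k + 2} = insert (j + 5) (insert (j + 4) (insert (j + 3) {3..j + 2}))"
        using 4 by auto
      moreover have "trib (j + 5) = y + (x + trib (j + 2))"
        using trib_step[of "j + 2"] by (simp add: x_def y_def numeral_eq_Suc)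
      moreover have "trib (j + 2) \<in> S" using 4 by (auto simp: S_def)
      ultimately show ?thesis by (auto simp: x_def y_def S_def)
    qed
    moreover have "Suc (Suc (2 * j div 3 + 1)) = 2 * k div 3 + 1" using 4 by simp
    ultimately show ?thesis by (metis can_empty_in_subset)
  qed
qed

section \<open>Lower bound\<close>

lemma can_empty_in_trib_lower:
  assumes "k \<ge> 1" "can_empty_in (trib ` {3..k + 2}) n"
  shows "2 * k div 3 + 1 \<le> n"
proof -
  obtain a where "trib ` {3..k + 2} \<subseteq> sum a ` Pow {..<n}"
    using assms(2) unfolding can_empty_in_iff by blast
  then have "\<forall>i\<in>{3..k + 2}. \<exists>B. B \<subseteq> {..<n} \<and> trib i = sum a B" by blast
  then obtain A where A: "\<And>i. i \<in> {3..k + 2} \<Longrightarrow> A i \<subseteq> {..<n}"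
      "\<And>i. i \<in> {3..k + 2} \<Longrightarrow> trib i = sum a (A i)"
    by metis
  \<comment> \<open>The indices of the amounts used by the jars up to \<open>trib j\<close>. The
    bound on \<open>n\<close> comes from the growth of \<open>card (G j)\<close>.\<close>
  define G where "G = (\<lambda>j. \<Union>i\<in>{3..j}. A i)"
  have G_sub: "G j \<subseteq> {..<n}" if "j \<le> k + 2" for j
    using A(1) that unfolding G_def by fastforce
  have fin: "finite (G j)" if "j \<le> k + 2" for j
    using G_sub[OF that] finite_subset by blast
  have G_Suc: "G (Suc j) = G j \<union> A (Suc j)" if "2 \<le> j" for j
    using that by (simp add: G_def atLeastAtMostSuc_conv Un_commute)
  have sum_Un: "sum a (X \<union> Y) \<le> sum a X + sum a Y" if "finite X" "finite Y" for X Y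
    using sum.union_inter[OF that, of a] by linarith
  have sum_G: "sum a (G j) \<le> (\<Sum>i=3..j. trib i)" if "j \<le> k + 2" for j
    using that
  proof (induction j)
    case 0
    then show ?case by (simp add: G_def)
  next
    case (Suc j)
    show ?case
    proof (cases "2 \<le> j")
      case True
      have "A (Suc j) \<subseteq> {..<n}" using A(1) Suc.prems True by simp
      then have "finite (A (Suc j))" using finite_subset by blast
      then show ?thesis
        using sum_Un[of "G j" "A (Suc j)"] fin[of j] A(2)[of "Suc j"] Suc True
        by (simp add: G_Suc)
    qed (simp add: G_def)
  qed
  have G_mono: "G j \<subseteq> G (Suc j)" for j
    unfolding G_def by (rule UN_mono) auto
  have card_le: "card (G j) \<le> card (G (Suc j))" if "Suc j \<le> k + 2" for j
    using card_mono[OF fin[OF that] G_mono] .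
  have card_less: "card (G j) < card (G (Suc j))"
    if "Suc j \<le> k + 2" "2 \<le> j" "sum a (G j) < trib (Suc j)" for j
  proof (rule psubset_card_mono[OF fin[OF that(1)]])
    have "\<not> A (Suc j) \<subseteq> G j"
    proof
      assume "A (Suc j) \<subseteq> G j"
      then have "sum a (A (Suc j)) \<le> sum a (G j)"
        using fin[of j] that by (intro sum_mono2) auto
      then show False using A(2)[of "Suc j"] that by simp
    qed
    then show "G j \<subset> G (Suc j)" using that by (auto simp: G_Suc)
  qed
  have same: "G (Suc j) = G j" if "card (G (Suc j)) \<le> card (G j)" "Suc j \<le> k + 2" for j
    using card_seteq[OF fin[OF that(2)] G_mono that(1)] by simp
  have step: "card (G j) + 2 \<le> card (G (j + 3))" if j: "3 \<le> j" "j + 3 \<le> k + 2" for j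
  proof -
    \<comment> \<open>Two adjacent jars cannot both do without a new amount: otherwise the sum over
      \<open>G i\<close>, which is below \<open>trib (i + 2)\<close>, would have to cover
      \<open>trib (i + 2)\<close>.\<close>
    have consecutive: "card (G i) < card (G (Suc (Suc i)))" if "j \<le> i" "i \<le> j + 1" for i
    proof (rule ccontr)
      assume "\<not> ?thesis"
      then have le: "card (G (Suc (Suc i))) \<le> card (G i)" by simp
      then have "G (Suc i) = G i"
        using same[of i] card_le[of "Suc i"] j that by simp
      moreover have "sum a (G i) < trib (Suc (Suc i))"
        using sum_G[of i] sum_trib_less[of i] that j by simp
      ultimately have "card (G (Suc i)) < card (G (Suc (Suc i)))"
        using card_less[of "Suc i"] that j by simp
      then show False using le card_le[of i] that j by simp
    qed
    \<comment> \<open>The first and third of the three jars cannot both do without one either. If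
      the first does, the amounts in \<open>G (j + 2)\<close> sum to less than
      \<open>trib j + trib (j + 1) + trib (j + 2)\<close>, which is
      \<open>trib (j + 3)\<close>.\<close>
    have alternate: "card (G (j + 2)) < card (G (j + 3))" if "card (G (j + 1)) \<le> card (G j)"
    proof -
      have "G (j + 1) = G j" using same[of j] that j by simp
      then have "G (j + 2) = G j \<union> A (j + 2)" using G_Suc[of "Suc j"] j by simp
      moreover have "finite (A (j + 2))"
        using A(1)[of "j + 2"] j finite_subset[of _ "{..<n}"] by simp
      ultimately have "sum a (G (j + 2)) \<le> sum a (G j) + trib (j + 2)"
        using sum_Un[of "G j" "A (j + 2)"] fin[of j] A(2)[of "j + 2"] j by simp
      \<comment> \<open>Splitting off the last summand \<open>trib j\<close> leaves a sum up to
        \<open>j - 1\<close>, which is below \<open>trib (j + 1)\<close>.\<close>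
      moreover have "sum a (G j) < trib (j + 1) + trib j"
      proof -
        obtain i where i: "j = Suc i" using j by (cases j) auto
        have "(\<Sum>i=3..j. trib i) = (\<Sum>i=3..i. trib i) + trib j" using i j by simp
        then show ?thesis using sum_G[of j] sum_trib_less[of i] i j by simp
      qed
      ultimately have "sum a (G (j + 2)) < trib (j + 3)" using trib_step[of j] by simp
      then show ?thesis using card_less[of "j + 2"] j by (simp add: numeral_eq_Suc)
    qed
    \<comment> \<open>Every pair among the three jars contains one that needs a new amount, so at
      least two of the three increments are positive.\<close>
    show ?thesis
      using consecutive[of j] consecutive[of "j + 1"] alternate
        card_le[of j] card_le[of "j + 1"] card_le[of "j + 2"] j
      by (simp add: numeral_eq_Suc) linarith
  qed
  have "m \<ge> 1 \<Longrightarrow> m \<le> k \<Longrightarrow> 2 * m div 3 + 1 \<le> card (G (m + 2))" for m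
  proof (induction m rule: less_induct)
    case (less m)
    \<comment> \<open>Each of the first three jars exceeds the sum of all earlier ones (0 < 1, 1 <
      2, 3 < 4) and so needs a new amount.\<close>
    have *: "1 \<le> card (G 3)"
      using card_less[of 2] less.prems by (simp add: G_def trib_3_4_5)
    have **: "2 \<le> card (G 4)" if "2 \<le> m"
      using card_less[of 3] sum_G[of 3] less.prems that * by (simp add: trib_3_4_5)
    have ***: "3 \<le> card (G 5)" if "3 \<le> m"
    proof -
      have "(\<Sum>i=3..4. trib i) = 3" by (simp add: numeral_eq_Suc)
      then show ?thesis
        using card_less[of 4] sum_G[of 4] less.prems that ** by (simp add: trib_3_4_5)
    qed
    consider "m = 1" | "m = 2" | "m = 3" | "m \<ge> 4"
      using less.prems by linarith
    then show ?case
    proof cases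
      case 1
      then have "m + 2 = 3" "2 * m div 3 + 1 = 1" by simp_all
      then show ?thesis using * by (simp only:)
    next
      case 2
      then have "m + 2 = 4" "2 * m div 3 + 1 = 2" by simp_all
      then show ?thesis using **[OF eq_imp_le[OF 2[symmetric]]] by (simp only:)
    next
      case 3
      then have "m + 2 = 5" "2 * m div 3 + 1 = 3" by simp_all
      then show ?thesis using ***[OF eq_imp_le[OF 3[symmetric]]] by (simp only:)
    next
      case 4
      define j where "j = m - 3"
      have "m = j + 3" "j \<ge> 1" using 4 by (auto simp: j_def)
      then show ?thesis
        using less.IH[of j] step[of "j + 2"] less.prems by simp
    qed
  qed
  from this[of k] assms(1) have "2 * k div 3 + 1 \<le> card (G (k + 2))" by simp
  also have "\<dots> \<le> n" using card_mono[OF _ G_sub[of "k + 2"]] by simp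
  finally show ?thesis .
qed

theorem theorem9:
  fixes k :: nat
  assumes "k \<ge> 1"
  shows "CM (trib ` {3..k + 2}) = (2 * k) div 3 + 1"
  unfolding CM_def
  using can_empty_in_trib[OF assms] can_empty_in_trib_lower[OF assms]
  by (rule Least_equality)

end
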